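(* Let $\mathcal{E}$ be a basis of sets in a $\sigma$-finite measure space $(\Omega,|\cdot|)$ and suppose $X$ is a quasi-Banach function space over $\Omega$ for which $M^{\mathcal{E}}:X\to X$ is bounded. Then $\mathbf{1}_E\in X$ and $\mathbf{1}_E\in X'$ with \[ |E|\leq\|\mathbf{1}_E\|_X\|\mathbf{1}_E\|_{X'}\leq\|M^{\mathcal{E}}\|_{X\to X}|E| \] for all $E\in\mathcal{E}$. In particular, $X'$ is saturated and, hence, a Banach function space over $\Omega$.
   Context: $L^0(\Omega)$: a.e. finite measurable functions on $\Omega$ (of positive measure). A basis of sets in $\Omega$ is a collection $\mathcal{E}$ of measurable sets $E$ with $0<|E|<\infty$ such that (1) $\bigcup_{E\in\mathcal{E}}E=\Omega$; (2) any $x_1,x_2\in\Omega$ lie in a common $E\in\mathcal{E}$; (3) there is a countable $\mathcal{E}'\subseteq\mathcal{E}$ such that for all $\varepsilon>0$, $E\in\mathcal{E}$ there is $E'\in\mathcal{E}'$ with $E\subseteq E'$, $|E'|\le(1+\varepsilon)|E|$. $\langle f\rangle_{1,E}=|E|^{-1}\int_E|f|$ and $M^{\mathcal{E}}f=\sup_{E\in\mathcal{E}}\langle f\rangle_{1,E}\mathbf{1}_E$. A quasi-Banach function space over $\Omega$ is a vector space $X\subseteq L^0(\Omega)$ with a quasi-norm such that: (ideal) $f\in X$, $g\in L^0$, $|g|\le|f|$ imply $g\in X$, $\|g\|_X\le\|f\|_X$; (Fatou) $0\le f_n\uparrow f$, $f_n\in X$, $\sup_n\|f_n\|_X<\infty$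 imply $f\in X$, $\|f\|_X=\sup_n\|f_n\|_X$; (saturation) every measurable set of positive measure contains a measurable $F$ of positive measure with $\mathbf{1}_F\in X$ (such $X$ is called saturated). It is a Banach function space if the quasi-norm is a norm. $X'=\{g\in L^0: fg\in L^1\ \forall f\in X\}$, $\|g\|_{X'}=\sup_{\|f\|_X=1}\|fg\|_{L^1}$. *)

theory Defs
  imports "HOL-Analysis.Analysis"
begin

text \<open>
  Elements of the space of a.e. finite measurable functions are represented by real-valued
  Borel measurable functions. They are not quotiented by a.e. equality; instead all pointwise
  relations are required almost everywhere, so that the ideal property makes a function space
  closed under a.e. equality, with equal norms. Norms take values in \<^typ>\<open>ennreal\<close>, with
  finiteness on the space being part of the axioms; their values outside the space are irrelevant.
\<close>

definition basis_of_sets :: "'a measure \<Rightarrow> 'a set set \<Rightarrow> bool" where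
  "basis_of_sets M \<E> \<longleftrightarrow>
     \<E> \<subseteq> sets M \<and>
     (\<forall>E\<in>\<E>. 0 < emeasure M E \<and> emeasure M E < \<infinity>) \<and>
     \<Union>\<E> = space M \<and>
     (\<forall>x\<in>space M. \<forall>y\<in>space M. \<exists>E\<in>\<E>. x \<in> E \<and> y \<in> E) \<and>
     (\<exists>\<E>'\<subseteq>\<E>. countable \<E>' \<and>
        (\<forall>\<epsilon>::real. \<epsilon> > 0 \<longrightarrow>
          (\<forall>E\<in>\<E>. \<exists>E'\<in>\<E>'. E \<subseteq> E' \<and> emeasure M E' \<le> ennreal (1 + \<epsilon>) * emeasure M E)))"

definition average :: "'a measure \<Rightarrow> 'a set \<Rightarrow> ('a \<Rightarrow> real) \<Rightarrow> ennreal" where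
  "average M E f = (\<integral>\<^sup>+x\<in>E. ennreal \<bar>f x\<bar> \<partial>M) / emeasure M E"

definition maximal_function ::
  "'a measure \<Rightarrow> 'a set set \<Rightarrow> ('a \<Rightarrow> real) \<Rightarrow> 'a \<Rightarrow> ennreal" where
  "maximal_function M \<E> f x = (SUP E\<in>\<E>. average M E f * indicator E x)"

definition function_subspace :: "'a measure \<Rightarrow> ('a \<Rightarrow> real) set \<Rightarrow> bool" where
  "function_subspace M X \<longleftrightarrow>
     X \<subseteq> borel_measurable M \<and>
     (\<lambda>x. 0) \<in> X \<and>
     (\<forall>f\<in>X. \<forall>g\<in>X. (\<lambda>x. f x + g x) \<in> X) \<and>
     (\<forall>c. \<forall>f\<in>X. (\<lambda>x. c * f x) \<in> X)"

definition quasi_norm_with_const ::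
  "'a measure \<Rightarrow> ('a \<Rightarrow> real) set \<Rightarrow> (('a \<Rightarrow> real) \<Rightarrow> ennreal) \<Rightarrow> real \<Rightarrow> bool" where
  "quasi_norm_with_const M X N K \<longleftrightarrow>
     (\<forall>f\<in>X. N f < \<infinity>) \<and>
     (\<forall>f\<in>X. N f = 0 \<longleftrightarrow> (AE x in M. f x = 0)) \<and>
     (\<forall>c. \<forall>f\<in>X. N (\<lambda>x. c * f x) = ennreal \<bar>c\<bar> * N f) \<and>
     (\<forall>f\<in>X. \<forall>g\<in>X. N (\<lambda>x. f x + g x) \<le> ennreal K * (N f + N g))"

definition quasi_norm_on ::
  "'a measure \<Rightarrow> ('a \<Rightarrow> real) set \<Rightarrow> (('a \<Rightarrow> real) \<Rightarrow> ennreal) \<Rightarrow> bool" where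
  "quasi_norm_on M X N \<longleftrightarrow> (\<exists>K. quasi_norm_with_const M X N K)"

definition norm_on ::
  "'a measure \<Rightarrow> ('a \<Rightarrow> real) set \<Rightarrow> (('a \<Rightarrow> real) \<Rightarrow> ennreal) \<Rightarrow> bool" where
  "norm_on M X N \<longleftrightarrow> quasi_norm_with_const M X N 1"

definition ideal_property ::
  "'a measure \<Rightarrow> ('a \<Rightarrow> real) set \<Rightarrow> (('a \<Rightarrow> real) \<Rightarrow> ennreal) \<Rightarrow> bool" where
  "ideal_property M X N \<longleftrightarrow>
     (\<forall>f\<in>X. \<forall>g\<in>borel_measurable M.
        (AE x in M. \<bar>g x\<bar> \<le> \<bar>f x\<bar>) \<longrightarrow> g \<in> X \<and> N g \<le> N f)"

text \<open>
  The limit function below is a.e. finite by assumption. Given the other axioms, this is no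
  loss: if \<open>f\<^sub>n\<close> increases to \<open>\<infinity>\<close> on \<open>A\<close>, apply the property to
  \<open>min f\<^sub>n (k 1\<^sub>A)\<close>, which increases to \<open>k 1\<^sub>A\<close>, for every \<open>k\<close>; the norm of \<open>1\<^sub>A\<close> is then
  \<open>0\<close>, so \<open>A\<close> is a null set.
\<close>

definition fatou_property ::
  "'a measure \<Rightarrow> ('a \<Rightarrow> real) set \<Rightarrow> (('a \<Rightarrow> real) \<Rightarrow> ennreal) \<Rightarrow> bool" where
  "fatou_property M X N \<longleftrightarrow>
     (\<forall>F f. (\<forall>n::nat. F n \<in> X) \<longrightarrow> f \<in> borel_measurable M \<longrightarrow>
        (AE x in M. (\<forall>n. 0 \<le> F n x) \<and> incseq (\<lambda>n. F n x) \<and> (\<lambda>n. F n x) \<longlonglongrightarrow> f x) \<longrightarrow>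
        (SUP n. N (F n)) < \<infinity> \<longrightarrow>
        f \<in> X \<and> N f = (SUP n. N (F n)))"

definition saturated :: "'a measure \<Rightarrow> ('a \<Rightarrow> real) set \<Rightarrow> bool" where
  "saturated M X \<longleftrightarrow>
     (\<forall>A\<in>sets M. emeasure M A > 0 \<longrightarrow>
        (\<exists>F\<in>sets M. F \<subseteq> A \<and> emeasure M F > 0 \<and> indicator F \<in> X))"

text \<open>Completeness is not an axiom; it is a consequence of the Fatou property.\<close>

definition quasi_banach_function_space ::
  "'a measure \<Rightarrow> ('a \<Rightarrow> real) set \<Rightarrow> (('a \<Rightarrow> real) \<Rightarrow> ennreal) \<Rightarrow> bool" where
  "quasi_banach_function_space M X N \<longleftrightarrow>
     function_subspace M X \<and> quasi_norm_on M X N \<and>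
     ideal_property M X N \<and> fatou_property M X N \<and> saturated M X"

definition banach_function_space ::
  "'a measure \<Rightarrow> ('a \<Rightarrow> real) set \<Rightarrow> (('a \<Rightarrow> real) \<Rightarrow> ennreal) \<Rightarrow> bool" where
  "banach_function_space M X N \<longleftrightarrow> quasi_banach_function_space M X N \<and> norm_on M X N"

definition assoc_space :: "'a measure \<Rightarrow> ('a \<Rightarrow> real) set \<Rightarrow> ('a \<Rightarrow> real) set" where
  "assoc_space M X =
     {g \<in> borel_measurable M. \<forall>f\<in>X. integrable M (\<lambda>x. f x * g x)}"

definition assoc_norm ::
  "'a measure \<Rightarrow> ('a \<Rightarrow> real) set \<Rightarrow> (('a \<Rightarrow> real) \<Rightarrow> ennreal) \<Rightarrow> ('a \<Rightarrow> real) \<Rightarrow> ennreal" where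
  "assoc_norm M X N g = (SUP f\<in>{f\<in>X. N f = 1}. \<integral>\<^sup>+x. ennreal \<bar>f x * g x\<bar> \<partial>M)"

text \<open>
  The operators below may take the value \<open>\<infinity>\<close>. Such a function belongs to \<open>X\<close> if it is a.e.
  finite and its real-valued version, which changes it on a null set only, lies in \<open>X\<close>.
\<close>

definition maps_to_itself ::
  "'a measure \<Rightarrow> ('a \<Rightarrow> real) set \<Rightarrow> (('a \<Rightarrow> real) \<Rightarrow> 'a \<Rightarrow> ennreal) \<Rightarrow> bool" where
  "maps_to_itself M X T \<longleftrightarrow>
     (\<forall>f\<in>X. (AE x in M. T f x < \<infinity>) \<and> (\<lambda>x. enn2real (T f x)) \<in> X)"

definition bounded_operator_on ::
  "'a measure \<Rightarrow> ('a \<Rightarrow> real) set \<Rightarrow> (('a \<Rightarrow> real) \<Rightarrow> ennreal) \<Rightarrow>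
     (('a \<Rightarrow> real) \<Rightarrow> 'a \<Rightarrow> ennreal) \<Rightarrow> bool" where
  "bounded_operator_on M X N T \<longleftrightarrow>
     maps_to_itself M X T \<and>
     (\<exists>C::real. \<forall>f\<in>X. N (\<lambda>x. enn2real (T f x)) \<le> ennreal C * N f)"

definition operator_norm ::
  "('a \<Rightarrow> real) set \<Rightarrow> (('a \<Rightarrow> real) \<Rightarrow> ennreal) \<Rightarrow>
     (('a \<Rightarrow> real) \<Rightarrow> 'a \<Rightarrow> ennreal) \<Rightarrow> ennreal" where
  "operator_norm X N T = (SUP f\<in>{f\<in>X. N f = 1}. N (\<lambda>x. enn2real (T f x)))"

end

theory Submission
  imports Defs
begin

text \<open>
  Write \<open>T\<close> for the maximal operator and \<open>a\<close> for the average of \<open>\<bar>f\<bar>\<close> over \<open>E\<close>. Then \<open>T f\<close> is at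
  least \<open>a\<close> everywhere on \<open>E\<close>, that is, \<open>a 1\<^sub>E \<le> T f\<close>. This one inequality places \<open>1\<^sub>E\<close> in both
  spaces and gives the upper estimate. By saturation, \<open>E\<close> contains a set \<open>F\<close> of positive measure
  with \<open>1\<^sub>F \<in> X\<close>; for \<open>f = 1\<^sub>F\<close> we have \<open>a > 0\<close>, so the ideal property puts \<open>1\<^sub>E\<close> into \<open>X\<close>. For
  arbitrary \<open>f \<in> X\<close>, almost everywhere finiteness of \<open>T f\<close> makes \<open>a\<close> finite, so \<open>1\<^sub>E \<in> X'\<close>. For
  \<open>f\<close> of norm \<open>1\<close>, taking norms gives \<open>a \<parallel>1\<^sub>E\<parallel> \<le> \<parallel>T\<parallel>\<close>; multiplied by the measure of \<open>E\<close>, it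
  becomes the upper estimate after a supremum over \<open>f\<close> (lemma \<open>norm_mult_assoc_norm_le\<close>). The
  lower estimate is Hoelder's inequality for the pair \<open>1\<^sub>E, 1\<^sub>E\<close>. Saturation of \<open>X'\<close> follows
  because countably many sets of the basis cover the space.

  That \<open>X'\<close>, once saturated, is a Banach function space is a general fact. Its
  Fatou property is monotone convergence and the triangle inequality is that of the integral,
  whatever the constant in the quasi-norm of \<open>X\<close>. The substantial point is that the associate
  norm is finite on \<open>X'\<close>, a uniform boundedness principle
  (lemma \<open>assoc_space_iff\<close>). It rests on the Fatou property of \<open>X\<close>, which makes it possible to sum
  rapidly decreasing multiples of countably many unit vectors inside \<open>X\<close>
  (lemma \<open>unit_vectors_simultaneously_dominated\<close>).
\<close>

section \<open>Quasi-Banach function spaces\<close>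

context
  fixes M :: "'a measure"
    and X :: "('a \<Rightarrow> real) set"
    and N :: "('a \<Rightarrow> real) \<Rightarrow> ennreal"
  assumes qbfs: "quasi_banach_function_space M X N"
begin

lemma measurable_if_in_space: "f \<in> X \<Longrightarrow> f \<in> borel_measurable M"
  using qbfs by (auto simp: quasi_banach_function_space_def function_subspace_def)

lemma ideal:
  assumes "f \<in> X" "g \<in> borel_measurable M" "AE x in M. \<bar>g x\<bar> \<le> \<bar>f x\<bar>"
  shows "g \<in> X" "N g \<le> N f"
  using qbfs assms unfolding quasi_banach_function_space_def ideal_property_def by blast+

lemma scale_in_space: "f \<in> X \<Longrightarrow> (\<lambda>x. c * f x) \<in> X"
  using qbfs by (auto simp: quasi_banach_function_space_def function_subspace_def)

lemma add_in_space: "f \<in> X \<Longrightarrow> g \<in> X \<Longrightarrow> (\<lambda>x. f x + g x) \<in> X"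
  using qbfs by (auto simp: quasi_banach_function_space_def function_subspace_def)

lemma zero_in_space: "(\<lambda>x. 0) \<in> X"
  using qbfs by (auto simp: quasi_banach_function_space_def function_subspace_def)

lemma quasi_norm_finite: "f \<in> X \<Longrightarrow> N f < \<infinity>"
  using qbfs
  by (auto simp: quasi_banach_function_space_def quasi_norm_on_def quasi_norm_with_const_def)

lemma quasi_norm_eq_0_iff: "f \<in> X \<Longrightarrow> N f = 0 \<longleftrightarrow> (AE x in M. f x = 0)"
  using qbfs
  by (auto simp: quasi_banach_function_space_def quasi_norm_on_def quasi_norm_with_const_def)

lemma quasi_norm_scale: "f \<in> X \<Longrightarrow> N (\<lambda>x. c * f x) = ennreal \<bar>c\<bar> * N f"
  using qbfs
  by (auto simp: quasi_banach_function_space_def quasi_norm_on_def quasi_norm_with_const_def)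

lemma quasi_triangle_constant:
  obtains K :: real where "1 \<le> K"
    "\<And>f g. f \<in> X \<Longrightarrow> g \<in> X \<Longrightarrow> N (\<lambda>x. f x + g x) \<le> ennreal K * (N f + N g)"
proof -
  obtain K where K: "\<And>f g. f \<in> X \<Longrightarrow> g \<in> X \<Longrightarrow> N (\<lambda>x. f x + g x) \<le> ennreal K * (N f + N g)"
    using qbfs
    unfolding quasi_banach_function_space_def quasi_norm_on_def quasi_norm_with_const_def by blast
  show ?thesis
  proof
    show "1 \<le> max K 1" by simp
    fix f g assume "f \<in> X" "g \<in> X"
    then have "N (\<lambda>x. f x + g x) \<le> ennreal K * (N f + N g)" by (rule K)
    also have "\<dots> \<le> ennreal (max K 1) * (N f + N g)"
      by (intro mult_right_mono ennreal_leI) auto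
    finally show "N (\<lambda>x. f x + g x) \<le> ennreal (max K 1) * (N f + N g)" .
  qed
qed

lemma fatou:
  assumes "\<And>n::nat. F n \<in> X" "f \<in> borel_measurable M"
    "AE x in M. (\<forall>n. 0 \<le> F n x) \<and> incseq (\<lambda>n. F n x) \<and> (\<lambda>n. F n x) \<longlonglongrightarrow> f x"
    "(SUP n. N (F n)) < \<infinity>"
  shows "f \<in> X" "N f = (SUP n. N (F n))"
proof -
  have "fatou_property M X N"
    using qbfs by (simp add: quasi_banach_function_space_def)
  then have "f \<in> X \<and> N f = (SUP n. N (F n))"
    unfolding fatou_property_def using assms by blast
  then show "f \<in> X" "N f = (SUP n. N (F n))" by auto
qed

lemma indicator_subset_in_space:
  assumes "A \<in> sets M" "emeasure M A > 0"
  obtains F where "F \<in> sets M" "F \<subseteq> A" "emeasure M F > 0" "(indicator F :: 'a \<Rightarrow> real) \<in> X"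
  using qbfs assms unfolding quasi_banach_function_space_def saturated_def by blast

lemma normalise:
  assumes "f \<in> X" "N f \<noteq> 0"
  obtains c where "c > 0" "N f = ennreal c" "(\<lambda>x. inverse c * f x) \<in> X"
    "N (\<lambda>x. inverse c * f x) = 1"
proof -
  obtain c where c: "c \<ge> 0" "N f = ennreal c"
    using quasi_norm_finite[OF assms(1)] by (cases "N f") auto
  with assms(2) have "c > 0" by (cases "c = 0") auto
  moreover have "N (\<lambda>x. inverse c * f x) = 1"
    using \<open>c > 0\<close> c quasi_norm_scale[OF assms(1), of "inverse c"]
    by (simp flip: ennreal_mult)
  ultimately show ?thesis using that c scale_in_space[OF assms(1)] by blast
qed

text \<open>
  An increasing sequence of bounded norm cannot tend to \<open>\<infinity>\<close> on a set \<open>A\<close> of positive measure: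
  its truncations at height \<open>k\<close> on \<open>A\<close> increase to \<open>k 1\<^sub>A\<close>, so the Fatou property bounds
  \<open>k \<parallel>1\<^sub>A\<parallel>\<close> independently of \<open>k\<close>, and \<open>A\<close> is a null set. Hence a real-valued limit exists, and the Fatou property
  places it in \<open>X\<close>.
\<close>

lemma bounded_increasing_sequence_dominated:
  assumes F: "\<And>n::nat. F n \<in> X" and nonneg: "\<And>n x. 0 \<le> F n x"
    and inc: "\<And>x. incseq (\<lambda>n. F n x)" and bound: "\<And>n. N (F n) \<le> ennreal B"
  obtains f where "f \<in> X" "AE x in M. \<forall>n. F n x \<le> f x"
proof -
  define S where "S x = (SUP n. ennreal (F n x))" for x
  have [measurable]: "F n \<in> borel_measurable M" for n
    by (rule measurable_if_in_space[OF F])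
  have [measurable]: "S \<in> borel_measurable M" unfolding S_def by measurable
  define A where "A = {x \<in> space M. S x = \<infinity>}"
  have [measurable]: "A \<in> sets M" unfolding A_def by measurable
  have trunc: "(\<lambda>x. real k * indicator A x) \<in> X \<and> N (\<lambda>x. real k * indicator A x) \<le> ennreal B" for k
  proof -
    define G where "G n x = min (F n x) (real k * indicator A x)" for n x
    have GX: "G n \<in> X" "N (G n) \<le> N (F n)" for n
    proof -
      have "G n \<in> borel_measurable M" unfolding G_def by measurable
      moreover have "AE x in M. \<bar>G n x\<bar> \<le> \<bar>F n x\<bar>" using nonneg[of n] by (simp add: G_def)
      ultimately show "G n \<in> X" "N (G n) \<le> N (F n)" using ideal[OF F[of n]] by blast+
    qed
    have lim: "(\<lambda>n. G n x) \<longlonglongrightarrow> real k * indicator A x" for x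
    proof (cases "x \<in> A")
      case True
      then have "ennreal (real k) < S x" by (simp add: A_def)
      then obtain m where "ennreal (real k) < ennreal (F m x)"
        unfolding S_def less_SUP_iff by blast
      then have m: "real k \<le> F m x" by (simp add: ennreal_less_iff)
      have "G n x = real k * indicator A x" if "n \<ge> m" for n
        using m incseqD[OF inc that, of x] True by (simp add: G_def)
      then show ?thesis
        by (intro tendsto_eventually) (auto simp: eventually_sequentially)
    next
      case False then show ?thesis by (simp add: G_def nonneg)
    qed
    have SUP: "(SUP n. N (G n)) \<le> ennreal B"
      by (rule SUP_least) (meson GX(2) bound order_trans)
    have fat: "AE x in M. (\<forall>n. 0 \<le> G n x) \<and> incseq (\<lambda>n. G n x) \<and> (\<lambda>n. G n x) \<longlonglongrightarrow> real k * indicator A x"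
      using lim inc nonneg
      by (intro AE_I2) (auto simp: G_def incseq_def intro: min.coboundedI1)
    have fin: "(SUP n. N (G n)) < \<infinity>"
      using SUP by (auto intro: le_less_trans)
    show ?thesis
      using fatou[OF GX(1) _ fat fin] SUP by simp
  qed
  have IA: "(indicator A :: 'a \<Rightarrow> real) \<in> X" using trunc[of 1] by simp
  have "N (indicator A) = 0"
  proof -
    obtain a where a: "a \<ge> 0" "N (indicator A) = ennreal a"
      using quasi_norm_finite[OF IA] by (cases "N (indicator A)") auto
    have "real k * a \<le> max B 0" for k
    proof -
      have "ennreal (real k * a) \<le> ennreal B"
        using trunc[of k] quasi_norm_scale[OF IA, of "real k"] a by (simp add: ennreal_mult)
      then show ?thesis using a by (cases "B \<ge> 0") (auto simp: ennreal_neg)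
    qed
    then have "a = 0"
      using a reals_Archimedean3[of a] by (metis leD less_eq_real_def)
    with a show ?thesis by simp
  qed
  then have AE: "AE x in M. S x < \<infinity>"
    using quasi_norm_eq_0_iff[OF IA] by (auto simp: A_def indicator_def less_top[symmetric] elim!: AE_mp)
  define f where "f x = enn2real (S x)" for x
  have S: "ennreal (f x) = S x" if "S x < \<infinity>" for x
    using that by (simp add: f_def)
  have lim: "AE x in M. (\<forall>n. 0 \<le> F n x) \<and> incseq (\<lambda>n. F n x) \<and> (\<lambda>n. F n x) \<longlonglongrightarrow> f x"
    using AE
  proof eventually_elim
    case (elim x)
    have "incseq (\<lambda>n. ennreal (F n x))"
      using inc[of x] by (auto simp: incseq_def intro: ennreal_leI)
    then have "(\<lambda>n. ennreal (F n x)) \<longlonglongrightarrow> ennreal (f x)"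
      unfolding S[OF elim] unfolding S_def by (rule LIMSEQ_SUP)
    then have "(\<lambda>n. F n x) \<longlonglongrightarrow> f x"
      by (subst (asm) tendsto_ennreal_iff) (auto simp: nonneg f_def)
    then show ?case using nonneg inc by blast
  qed
  have "(SUP n. N (F n)) \<le> ennreal B" by (rule SUP_least) (rule bound)
  then have fin: "(SUP n. N (F n)) < \<infinity>" by (auto intro: le_less_trans)
  have "f \<in> X" by (rule fatou(1)[OF F _ lim fin]) (simp add: f_def[abs_def])
  moreover have "AE x in M. \<forall>n. F n x \<le> f x"
    using lim by eventually_elim (auto intro: incseq_le)
  ultimately show ?thesis by (rule that)
qed

text \<open>
  A substitute for absolute convergence that survives the constant \<open>K\<close> of the quasi-triangle
  inequality: for \<open>r = 1 / (2 K)\<close>, every finite sum of consecutive terms \<open>r\<^sup>k\<^sup>+\<^sup>1 \<bar>f\<^sub>k\<bar>\<close> that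
  starts at \<open>k = m\<close> has norm at most \<open>r\<^sup>m\<close>. By induction on the number of terms, peeling off
  the first one bounds the norm by \<open>K (r\<^sup>m\<^sup>+\<^sup>1 + r\<^sup>m\<^sup>+\<^sup>1) = r\<^sup>m\<close>. The order of quantifiers matters
  later: \<open>r\<close> does not depend on the sequence, so a sequence may be chosen with \<open>r\<close> in view.
\<close>

lemma unit_vectors_simultaneously_dominated:
  obtains r :: real where "r > 0"
    "\<And>f :: nat \<Rightarrow> 'a \<Rightarrow> real. (\<And>n. f n \<in> X) \<Longrightarrow> (\<And>n. N (f n) = 1) \<Longrightarrow>
       \<exists>h\<in>X. \<forall>n. AE x in M. r ^ Suc n * \<bar>f n x\<bar> \<le> h x"
proof -
  obtain K :: real where K: "1 \<le> K"
    "\<And>f g. f \<in> X \<Longrightarrow> g \<in> X \<Longrightarrow> N (\<lambda>x. f x + g x) \<le> ennreal K * (N f + N g)"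
    using quasi_triangle_constant by blast
  define r where "r = 1 / (2 * K)"
  have r: "r > 0" using K by (simp add: r_def)
  show ?thesis
  proof (rule that[OF r])
    fix f :: "nat \<Rightarrow> 'a \<Rightarrow> real" assume f: "\<And>n. f n \<in> X" and f1: "\<And>n. N (f n) = 1"
    have abs: "(\<lambda>x. \<bar>f n x\<bar>) \<in> X" "N (\<lambda>x. \<bar>f n x\<bar>) \<le> 1" for n
      using ideal[OF f[of n], of "\<lambda>x. \<bar>f n x\<bar>"] measurable_if_in_space[OF f[of n]] f1 by auto
    have summand: "(\<lambda>x. r ^ Suc n * \<bar>f n x\<bar>) \<in> X" "N (\<lambda>x. r ^ Suc n * \<bar>f n x\<bar>) \<le> ennreal (r ^ Suc n)" for n
    proof -
      show "(\<lambda>x. r ^ Suc n * \<bar>f n x\<bar>) \<in> X" by (rule scale_in_space[OF abs(1)])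
      show "N (\<lambda>x. r ^ Suc n * \<bar>f n x\<bar>) \<le> ennreal (r ^ Suc n)"
        unfolding quasi_norm_scale[OF abs(1)]
        using mult_left_mono[OF abs(2), of "ennreal (r ^ Suc n)"] r by simp
    qed
    \<comment> \<open>the offset \<open>m\<close> lets the induction peel off summands at the front\<close>
    have tail: "(\<lambda>x. \<Sum>k<n. r ^ Suc (k + m) * \<bar>f (k + m) x\<bar>) \<in> X \<and>
        N (\<lambda>x. \<Sum>k<n. r ^ Suc (k + m) * \<bar>f (k + m) x\<bar>) \<le> ennreal (r ^ m)" for n m
    proof (induction n arbitrary: m)
      case 0
      have "N (\<lambda>x. 0) = 0" using quasi_norm_eq_0_iff[OF zero_in_space] by simp
      then show ?case using zero_in_space by simp
    next
      case (Suc n)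
      let ?R = "\<lambda>x. \<Sum>k<n. r ^ Suc (k + Suc m) * \<bar>f (k + Suc m) x\<bar>"
      have eq: "(\<lambda>x. \<Sum>k<Suc n. r ^ Suc (k + m) * \<bar>f (k + m) x\<bar>) = (\<lambda>x. r ^ Suc m * \<bar>f m x\<bar> + ?R x)"
        by (simp add: sum.lessThan_Suc_shift del: sum.lessThan_Suc)
      have "N (\<lambda>x. r ^ Suc m * \<bar>f m x\<bar> + ?R x) \<le> ennreal K * (N (\<lambda>x. r ^ Suc m * \<bar>f m x\<bar>) + N ?R)"
        using Suc.IH[of "Suc m"] by (intro K(2) summand(1)) auto
      also have "\<dots> \<le> ennreal K * (ennreal (r ^ Suc m) + ennreal (r ^ Suc m))"
        using Suc.IH[of "Suc m"] summand(2)[of m] by (intro mult_left_mono add_mono) auto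
      also have "\<dots> = ennreal (K * (r ^ Suc m + r ^ Suc m))"
        using r K(1) by (simp add: ennreal_mult flip: ennreal_plus del: power_Suc)
      also have "K * (r ^ Suc m + r ^ Suc m) = r ^ m"
        using K(1) by (simp add: r_def field_simps)
      finally show ?case
        unfolding eq using Suc.IH[of "Suc m"] add_in_space[OF summand(1)[of m]] by blast
    qed
    define F where "F n x = (\<Sum>k<n. r ^ Suc k * \<bar>f k x\<bar>)" for n x
    have FX: "F n \<in> X" "N (F n) \<le> ennreal 1" for n
      using tail[of 0 n] by (simp_all add: F_def[abs_def])
    have pos: "0 \<le> F n x" for n x using r by (auto simp: F_def intro!: sum_nonneg)
    have inc: "incseq (\<lambda>n. F n x)" for x
      using r by (auto simp: F_def incseq_Suc_iff)
    obtain h where h: "h \<in> X" "AE x in M. \<forall>n. F n x \<le> h x"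
      using bounded_increasing_sequence_dominated[OF FX(1) pos inc FX(2)] by blast
    have "AE x in M. r ^ Suc n * \<bar>f n x\<bar> \<le> h x" for n
      using h(2)
    proof eventually_elim
      case (elim x)
      have "r ^ Suc n * \<bar>f n x\<bar> \<le> F (Suc n) x" using pos[of n x] by (simp add: F_def)
      with elim show ?case by (meson order_trans)
    qed
    with h(1) show "\<exists>h\<in>X. \<forall>n. AE x in M. r ^ Suc n * \<bar>f n x\<bar> \<le> h x" by blast
  qed
qed

section \<open>The associate space\<close>

lemma hoelder_assoc:
  assumes f: "f \<in> X" and [measurable]: "g \<in> borel_measurable M"
  shows "(\<integral>\<^sup>+x. ennreal \<bar>f x * g x\<bar> \<partial>M) \<le> N f * assoc_norm M X N g"
proof (cases "N f = 0")
  case True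
  then have "AE x in M. f x = 0" using quasi_norm_eq_0_iff[OF f] by simp
  then have "(\<integral>\<^sup>+x. ennreal \<bar>f x * g x\<bar> \<partial>M) = (\<integral>\<^sup>+x. 0 \<partial>M)"
    by (intro nn_integral_cong_AE) auto
  then show ?thesis by simp
next
  case False
  obtain c where c: "c > 0" "N f = ennreal c" "(\<lambda>x. inverse c * f x) \<in> X"
    "N (\<lambda>x. inverse c * f x) = 1" using normalise[OF f False] by blast
  note [measurable] = measurable_if_in_space[OF f]
  have "(\<integral>\<^sup>+x. ennreal \<bar>f x * g x\<bar> \<partial>M) = (\<integral>\<^sup>+x. ennreal c * ennreal \<bar>inverse c * f x * g x\<bar> \<partial>M)"
    using c(1) by (intro nn_integral_cong) (simp add: abs_mult field_simps flip: ennreal_mult)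
  also have "\<dots> = ennreal c * (\<integral>\<^sup>+x. ennreal \<bar>inverse c * f x * g x\<bar> \<partial>M)"
    by (rule nn_integral_cmult) measurable
  also have "\<dots> \<le> ennreal c * assoc_norm M X N g"
    unfolding assoc_norm_def using c by (intro mult_left_mono SUP_upper) auto
  finally show ?thesis using c(2) by simp
qed

text \<open>
  Membership in \<open>X'\<close> only says that each single functional value is finite. Finiteness of
  the supremum is a uniform boundedness principle, proved by contradiction: unit vectors \<open>f\<^sub>n\<close>
  with \<open>\<integral>\<bar>f\<^sub>n g\<bar> > n / r\<^sup>n\<^sup>+\<^sup>1\<close> would be dominated, after scaling by \<open>r\<^sup>n\<^sup>+\<^sup>1\<close>, by a single
  \<open>h \<in> X\<close>, and then \<open>\<integral>\<bar>h g\<bar> = \<infinity>\<close>.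
\<close>

lemma assoc_space_iff:
  "g \<in> assoc_space M X \<longleftrightarrow> g \<in> borel_measurable M \<and> assoc_norm M X N g < \<infinity>"
proof safe
  assume g: "g \<in> assoc_space M X"
  then show meas [measurable]: "g \<in> borel_measurable M" by (simp add: assoc_space_def)
  obtain r where r: "r > 0" and
    dom: "\<And>f :: nat \<Rightarrow> 'a \<Rightarrow> real. (\<And>n. f n \<in> X) \<Longrightarrow> (\<And>n. N (f n) = 1) \<Longrightarrow>
       \<exists>h\<in>X. \<forall>n. AE x in M. r ^ Suc n * \<bar>f n x\<bar> \<le> h x"
    using unit_vectors_simultaneously_dominated by blast
  show "assoc_norm M X N g < \<infinity>"
  proof (rule ccontr)
    assume "\<not> assoc_norm M X N g < \<infinity>"
    then have inf: "assoc_norm M X N g = \<infinity>" by (simp add: less_top[symmetric])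
    have "\<exists>f\<in>{f\<in>X. N f = 1}. ennreal (real n / r ^ Suc n) < (\<integral>\<^sup>+x. ennreal \<bar>f x * g x\<bar> \<partial>M)" for n
    proof -
      have "ennreal (real n / r ^ Suc n) < assoc_norm M X N g" unfolding inf by simp
      then show ?thesis unfolding assoc_norm_def less_SUP_iff .
    qed
    then obtain f where f: "\<And>n. f n \<in> X" "\<And>n. N (f n) = 1"
      "\<And>n. ennreal (real n / r ^ Suc n) < (\<integral>\<^sup>+x. ennreal \<bar>f n x * g x\<bar> \<partial>M)"
      by simp metis
    obtain h where h: "h \<in> X" "\<And>n. AE x in M. r ^ Suc n * \<bar>f n x\<bar> \<le> h x"
      using dom[of f, OF f(1,2)] by blast
    have [measurable]: "f n \<in> borel_measurable M" for n by (rule measurable_if_in_space[OF f(1)])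
    have "ennreal (real n) \<le> (\<integral>\<^sup>+x. ennreal \<bar>h x * g x\<bar> \<partial>M)" for n
    proof -
      have "ennreal (real n) = ennreal (r ^ Suc n) * ennreal (real n / r ^ Suc n)"
        using r by (simp flip: ennreal_mult)
      also have "\<dots> \<le> ennreal (r ^ Suc n) * (\<integral>\<^sup>+x. ennreal \<bar>f n x * g x\<bar> \<partial>M)"
        using f(3)[of n] by (intro mult_left_mono) auto
      also have "\<dots> = (\<integral>\<^sup>+x. ennreal (r ^ Suc n) * ennreal \<bar>f n x * g x\<bar> \<partial>M)"
        by (rule nn_integral_cmult[symmetric]) measurable
      also have "\<dots> \<le> (\<integral>\<^sup>+x. ennreal \<bar>h x * g x\<bar> \<partial>M)"
      proof (rule nn_integral_mono_AE, use h(2)[of n] in eventually_elim)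
        case (elim x)
        have "r ^ Suc n * \<bar>f n x\<bar> * \<bar>g x\<bar> \<le> \<bar>h x\<bar> * \<bar>g x\<bar>"
          using elim by (intro mult_right_mono) auto
        then show ?case using r
          by (simp add: abs_mult mult.assoc flip: ennreal_mult del: power_Suc)
      qed
      finally show ?thesis .
    qed
    moreover have "(\<integral>\<^sup>+x. ennreal \<bar>h x * g x\<bar> \<partial>M) < \<infinity>"
      using g h(1) by (simp add: assoc_space_def integrable_iff_bounded)
    then obtain b where b: "(\<integral>\<^sup>+x. ennreal \<bar>h x * g x\<bar> \<partial>M) = ennreal b" "b \<ge> 0"
      by (cases "\<integral>\<^sup>+x. ennreal \<bar>h x * g x\<bar> \<partial>M") auto
    ultimately have "real n \<le> b" for n by simp
    then show False using reals_Archimedean2[of b] by (meson leD)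
  qed
next
  assume g: "g \<in> borel_measurable M" "assoc_norm M X N g < \<infinity>"
  have "integrable M (\<lambda>x. f x * g x)" if f: "f \<in> X" for f
  proof -
    have "(\<integral>\<^sup>+x. ennreal \<bar>f x * g x\<bar> \<partial>M) \<le> N f * assoc_norm M X N g"
      by (rule hoelder_assoc[OF f g(1)])
    also have "\<dots> < \<infinity>" using g quasi_norm_finite[OF f] by (simp add: ennreal_mult_less_top)
    finally show ?thesis
      using g(1) measurable_if_in_space[OF f] by (simp add: integrable_iff_bounded)
  qed
  then show "g \<in> assoc_space M X" using g by (simp add: assoc_space_def)
qed

lemma assoc_norm_mono:
  assumes "AE x in M. \<bar>g x\<bar> \<le> \<bar>h x\<bar>"
  shows "assoc_norm M X N g \<le> assoc_norm M X N h"
proof -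
  have "(\<integral>\<^sup>+x. ennreal \<bar>f x * g x\<bar> \<partial>M) \<le> (\<integral>\<^sup>+x. ennreal \<bar>f x * h x\<bar> \<partial>M)" for f
    using assms by (intro nn_integral_mono_AE, eventually_elim)
      (auto simp: abs_mult intro!: ennreal_leI mult_left_mono)
  then show ?thesis unfolding assoc_norm_def by (intro SUP_mono) blast
qed

lemma assoc_norm_scale:
  assumes [measurable]: "g \<in> borel_measurable M"
  shows "assoc_norm M X N (\<lambda>x. c * g x) = ennreal \<bar>c\<bar> * assoc_norm M X N g"
  unfolding assoc_norm_def SUP_mult_left_ennreal
proof (rule SUP_cong[OF refl])
  fix f assume "f \<in> {f \<in> X. N f = 1}"
  then have [measurable]: "f \<in> borel_measurable M" by (auto intro: measurable_if_in_space)
  have "(\<integral>\<^sup>+x. ennreal \<bar>f x * (c * g x)\<bar> \<partial>M) = (\<integral>\<^sup>+x. ennreal \<bar>c\<bar> * ennreal \<bar>f x * g x\<bar> \<partial>M)"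
    by (intro nn_integral_cong) (simp add: abs_mult ac_simps flip: ennreal_mult)
  also have "\<dots> = ennreal \<bar>c\<bar> * (\<integral>\<^sup>+x. ennreal \<bar>f x * g x\<bar> \<partial>M)"
    by (rule nn_integral_cmult) measurable
  finally show "(\<integral>\<^sup>+x. ennreal \<bar>f x * (c * g x)\<bar> \<partial>M) = ennreal \<bar>c\<bar> * (\<integral>\<^sup>+x. ennreal \<bar>f x * g x\<bar> \<partial>M)" .
qed

lemma assoc_norm_triangle:
  assumes [measurable]: "g \<in> borel_measurable M" "h \<in> borel_measurable M"
  shows "assoc_norm M X N (\<lambda>x. g x + h x) \<le> assoc_norm M X N g + assoc_norm M X N h"
  unfolding assoc_norm_def[of M X N "\<lambda>x. g x + h x"]
proof (rule SUP_least)
  fix f assume f: "f \<in> {f \<in> X. N f = 1}"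
  then have [measurable]: "f \<in> borel_measurable M" by (auto intro: measurable_if_in_space)
  have "(\<integral>\<^sup>+x. ennreal \<bar>f x * (g x + h x)\<bar> \<partial>M) \<le> (\<integral>\<^sup>+x. ennreal \<bar>f x * g x\<bar> + ennreal \<bar>f x * h x\<bar> \<partial>M)"
    by (intro nn_integral_mono) (simp add: ring_distribs abs_triangle_ineq flip: ennreal_plus)
  also have "\<dots> = (\<integral>\<^sup>+x. ennreal \<bar>f x * g x\<bar> \<partial>M) + (\<integral>\<^sup>+x. ennreal \<bar>f x * h x\<bar> \<partial>M)"
    by (rule nn_integral_add) measurable
  also have "\<dots> \<le> assoc_norm M X N g + assoc_norm M X N h"
    unfolding assoc_norm_def using f by (intro add_mono SUP_upper) auto
  finally show "(\<integral>\<^sup>+x. ennreal \<bar>f x * (g x + h x)\<bar> \<partial>M) \<le> assoc_norm M X N g + assoc_norm M X N h" .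
qed

text \<open>
  Definiteness of the associate norm rests on saturation of \<open>X\<close>, which supplies test
  functions living on any given set where \<open>g \<noteq> 0\<close>.
\<close>

lemma assoc_norm_eq_0_iff:
  assumes [measurable]: "g \<in> borel_measurable M"
  shows "assoc_norm M X N g = 0 \<longleftrightarrow> (AE x in M. g x = 0)"
proof
  assume 0: "assoc_norm M X N g = 0"
  define A where "A = {x \<in> space M. g x \<noteq> 0}"
  have [measurable]: "A \<in> sets M" unfolding A_def by measurable
  have "emeasure M A = 0"
  proof (rule ccontr)
    assume "emeasure M A \<noteq> 0"
    then obtain F where F: "F \<in> sets M" "F \<subseteq> A" "emeasure M F > 0" "(indicator F :: 'a \<Rightarrow> real) \<in> X"
      using indicator_subset_in_space[of A] by (auto simp: zero_less_iff_neq_zero)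
    note [measurable] = F(1)
    have "(\<integral>\<^sup>+x. ennreal \<bar>indicator F x * g x\<bar> \<partial>M) \<le> 0"
      using hoelder_assoc[OF F(4) assms] 0 by simp
    then have "AE x in M. indicator F x * g x = 0"
      by (simp add: nn_integral_0_iff_AE)
    moreover have "AE x in M. x \<in> F \<longrightarrow> g x \<noteq> 0" using F(2) by (auto simp: A_def)
    ultimately have "AE x in M. x \<notin> F" by eventually_elim (auto simp: indicator_def split: if_splits)
    then show False using F(1,3) AE_iff_null_sets[of F M] by (auto simp: null_sets_def)
  qed
  then show "AE x in M. g x = 0"
    by (intro AE_I'[of A]) (auto simp: A_def null_sets_def)
next
  assume "AE x in M. g x = 0"
  then have "(\<integral>\<^sup>+x. ennreal \<bar>f x * g x\<bar> \<partial>M) = 0" for f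
    by (subst nn_integral_cong_AE[where v="\<lambda>_. 0"]) auto
  then have "assoc_norm M X N g \<le> 0"
    unfolding assoc_norm_def by (intro SUP_least) simp
  then show "assoc_norm M X N g = 0" by simp
qed

lemma assoc_norm_monotone_convergence:
  assumes [measurable]: "\<And>n::nat. G n \<in> borel_measurable M"
    and lim: "AE x in M. (\<forall>n. 0 \<le> G n x) \<and> incseq (\<lambda>n. G n x) \<and> (\<lambda>n. G n x) \<longlonglongrightarrow> g x"
  shows "assoc_norm M X N g = (SUP n. assoc_norm M X N (G n))"
  unfolding assoc_norm_def
proof (subst SUP_commute, rule SUP_cong[OF refl])
  fix f assume "f \<in> {f \<in> X. N f = 1}"
  then have [measurable]: "f \<in> borel_measurable M" by (auto intro: measurable_if_in_space)
  have inc: "AE x in M. incseq (\<lambda>n. ennreal \<bar>f x * G n x\<bar>)"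
    using lim by eventually_elim
      (auto simp: incseq_def abs_mult intro!: ennreal_leI mult_left_mono)
  have "(\<integral>\<^sup>+x. ennreal \<bar>f x * g x\<bar> \<partial>M) = (\<integral>\<^sup>+x. (SUP n. ennreal \<bar>f x * G n x\<bar>) \<partial>M)"
  proof (rule nn_integral_cong_AE, use lim inc in eventually_elim)
    case (elim x)
    then have "(\<lambda>n. ennreal \<bar>f x * G n x\<bar>) \<longlonglongrightarrow> ennreal \<bar>f x * g x\<bar>"
      by (intro tendsto_ennrealI tendsto_intros) auto
    with LIMSEQ_SUP[OF elim(2)] show ?case by (rule LIMSEQ_unique[rotated])
  qed
  also have "\<dots> = (SUP n. \<integral>\<^sup>+x. ennreal \<bar>f x * G n x\<bar> \<partial>M)"
    using inc by (intro nn_integral_monotone_convergence_SUP_AE) (auto simp: incseq_Suc_iff)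
  finally show "(\<integral>\<^sup>+x. ennreal \<bar>f x * g x\<bar> \<partial>M) = (SUP n. \<integral>\<^sup>+x. ennreal \<bar>f x * G n x\<bar> \<partial>M)" .
qed

lemma banach_function_space_assoc:
  assumes sat: "saturated M (assoc_space M X)"
  shows "banach_function_space M (assoc_space M X) (assoc_norm M X N)"
proof -
  have sub: "function_subspace M (assoc_space M X)"
    unfolding function_subspace_def
    by (auto simp: assoc_space_def algebra_simps)
  have norm: "quasi_norm_with_const M (assoc_space M X) (assoc_norm M X N) 1"
    unfolding quasi_norm_with_const_def
    by (auto simp: assoc_space_iff assoc_norm_eq_0_iff assoc_norm_scale assoc_norm_triangle)
  have ideal: "ideal_property M (assoc_space M X) (assoc_norm M X N)"
    unfolding ideal_property_def by (auto simp: assoc_space_iff intro: assoc_norm_mono le_less_trans[OF assoc_norm_mono])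
  have "fatou_property M (assoc_space M X) (assoc_norm M X N)"
    unfolding fatou_property_def
  proof (intro allI impI)
    fix F f
    assume *: "\<forall>n::nat. F n \<in> assoc_space M X" "f \<in> borel_measurable M"
      "AE x in M. (\<forall>n. 0 \<le> F n x) \<and> incseq (\<lambda>n. F n x) \<and> (\<lambda>n. F n x) \<longlonglongrightarrow> f x"
      "(SUP n. assoc_norm M X N (F n)) < \<infinity>"
    have "assoc_norm M X N f = (SUP n. assoc_norm M X N (F n))"
      using * by (intro assoc_norm_monotone_convergence) (auto simp: assoc_space_iff)
    with * show "f \<in> assoc_space M X \<and> assoc_norm M X N f = (SUP n. assoc_norm M X N (F n))"
      by (simp add: assoc_space_iff)
  qed
  with sub norm ideal sat show ?thesis
    by (auto simp: banach_function_space_def quasi_banach_function_space_def norm_on_def quasi_norm_on_def)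
qed

lemma emeasure_le_norm_mult_assoc_norm:
  assumes "E \<in> sets M" "(indicator E :: 'a \<Rightarrow> real) \<in> X"
  shows "emeasure M E \<le> N (indicator E) * assoc_norm M X N (indicator E)"
proof -
  have "emeasure M E = (\<integral>\<^sup>+x. ennreal \<bar>indicator E x * indicator E x\<bar> \<partial>M)"
    using assms(1) by (simp flip: nn_integral_indicator indicator_inter_arith add: ennreal_indicator)
  then show ?thesis using hoelder_assoc[OF assms(2), of "indicator E"] assms(1) by simp
qed

section \<open>Averages over the sets of a basis\<close>

context
  fixes \<E> :: "'a set set"
  assumes basis: "basis_of_sets M \<E>"
    and maps: "maps_to_itself M X (maximal_function M \<E>)"
begin

lemma basis_sets:
  assumes "E \<in> \<E>"
  shows "E \<in> sets M" "0 < emeasure M E" "emeasure M E < \<infinity>"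
  using basis assms by (auto simp: basis_of_sets_def)

lemma average_le_maximal_function:
  assumes "E \<in> \<E>" "x \<in> E"
  shows "average M E f \<le> maximal_function M \<E> f x"
  unfolding maximal_function_def using assms by (intro SUP_upper2[of E]) auto

text \<open>
  The maximal function is at least the average on all of \<open>E\<close>, and it is finite at some point
  of \<open>E\<close> because \<open>E\<close> is not a null set.
\<close>

lemma average_finite:
  assumes E: "E \<in> \<E>" and f: "f \<in> X"
  shows "average M E f < \<infinity>"
proof (rule ccontr)
  assume "\<not> average M E f < \<infinity>"
  then have "average M E f = \<infinity>" by (simp add: less_top[symmetric])
  then have "x \<notin> E" if "maximal_function M \<E> f x < \<infinity>" for x
    using average_le_maximal_function[OF E, of x f] that by auto
  moreover have "AE x in M. maximal_function M \<E> f x < \<infinity>"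
    using maps f by (simp add: maps_to_itself_def)
  ultimately have "AE x in M. x \<notin> E" by auto
  then show False using basis_sets[OF E] AE_iff_null_sets[of E M] by (auto simp: null_sets_def)
qed

lemma integral_eq_average:
  assumes E: "E \<in> \<E>" and f: "f \<in> X"
  shows "(\<integral>\<^sup>+x. ennreal \<bar>f x * indicator E x\<bar> \<partial>M) = average M E f * emeasure M E"
proof -
  have "(\<integral>\<^sup>+x. ennreal \<bar>f x * indicator E x\<bar> \<partial>M) = (\<integral>\<^sup>+x\<in>E. ennreal \<bar>f x\<bar> \<partial>M)"
    by (intro nn_integral_cong) (auto simp: indicator_def)
  also have "\<dots> = average M E f * emeasure M E"
    unfolding average_def using basis_sets[OF E] by (simp add: ennreal_divide_times)
  finally show ?thesis .
qed

lemma scaled_indicator_le_maximal_function: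
  assumes E: "E \<in> \<E>" and f: "f \<in> X"
  shows "(\<lambda>x. enn2real (average M E f) * indicator E x) \<in> X"
    "N (\<lambda>x. enn2real (average M E f) * indicator E x) \<le> N (\<lambda>x. enn2real (maximal_function M \<E> f x))"
proof -
  have mX: "(\<lambda>x. enn2real (maximal_function M \<E> f x)) \<in> X"
    and fin: "AE x in M. maximal_function M \<E> f x < \<infinity>"
    using maps f by (auto simp: maps_to_itself_def)
  have "AE x in M. \<bar>enn2real (average M E f) * indicator E x\<bar> \<le> \<bar>enn2real (maximal_function M \<E> f x)\<bar>"
    using fin
  proof eventually_elim
    case (elim x)
    then show ?case using average_le_maximal_function[OF E, of x f]
      by (auto simp: indicator_def intro!: enn2real_mono)
  qed
  moreover have "(\<lambda>x. enn2real (average M E f) * indicator E x) \<in> borel_measurable M"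
    using basis_sets[OF E] by measurable
  ultimately show "(\<lambda>x. enn2real (average M E f) * indicator E x) \<in> X"
    "N (\<lambda>x. enn2real (average M E f) * indicator E x) \<le> N (\<lambda>x. enn2real (maximal_function M \<E> f x))"
    using ideal[OF mX] by blast+
qed

text \<open>
  Saturation only provides some \<open>1\<^sub>F \<in> X\<close> with \<open>F \<subseteq> E\<close>; the maximal function spreads it over
  all of \<open>E\<close>, with positive height.
\<close>

lemma indicator_basis_in_space:
  assumes E: "E \<in> \<E>"
  shows "(indicator E :: 'a \<Rightarrow> real) \<in> X"
proof -
  obtain F where F: "F \<in> sets M" "F \<subseteq> E" "emeasure M F > 0" "(indicator F :: 'a \<Rightarrow> real) \<in> X"
    using indicator_subset_in_space[OF basis_sets(1,2)[OF E]] by blast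
  define a where "a = enn2real (average M E (indicator F))"
  have "(\<integral>\<^sup>+x\<in>E. ennreal \<bar>indicator F x\<bar> \<partial>M) = (\<integral>\<^sup>+x. indicator F x \<partial>M)"
    using F(2) by (intro nn_integral_cong) (auto simp: indicator_def)
  then have "average M E (indicator F) = emeasure M F / emeasure M E"
    using F(1) by (simp add: average_def)
  then have "average M E (indicator F) > 0"
    using F(3) basis_sets[OF E] by (simp add: ennreal_zero_less_divide)
  then have "a > 0"
    using average_finite[OF E F(4)] by (simp add: a_def enn2real_positive_iff)
  have "(\<lambda>x. inverse a * (a * indicator E x)) \<in> X"
    using scaled_indicator_le_maximal_function(1)[OF E F(4)] unfolding a_def by (rule scale_in_space)
  then show ?thesis using \<open>a > 0\<close> by (simp flip: mult.assoc)
qed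

lemma indicator_basis_in_assoc_space:
  assumes E: "E \<in> \<E>"
  shows "(indicator E :: 'a \<Rightarrow> real) \<in> assoc_space M X"
proof -
  have "integrable M (\<lambda>x. f x * indicator E x)" if f: "f \<in> X" for f
  proof -
    have "(\<integral>\<^sup>+x. ennreal \<bar>f x * indicator E x\<bar> \<partial>M) < \<infinity>"
      unfolding integral_eq_average[OF E f]
      using average_finite[OF E f] basis_sets[OF E] by (simp add: ennreal_mult_less_top)
    then show ?thesis
      using measurable_if_in_space[OF f] basis_sets(1)[OF E] by (simp add: integrable_iff_bounded)
  qed
  then show ?thesis using basis_sets(1)[OF E] by (simp add: assoc_space_def)
qed

text \<open>
  Only the norms of the maximal functions of unit vectors enter, because the associate norm is a supremum
  over unit vectors; so the constant is the operator norm itself.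
\<close>

lemma norm_mult_assoc_norm_le:
  assumes E: "E \<in> \<E>"
  shows "N (indicator E) * assoc_norm M X N (indicator E)
    \<le> operator_norm X N (maximal_function M \<E>) * emeasure M E"
  unfolding assoc_norm_def SUP_mult_left_ennreal
proof (rule SUP_least)
  fix f assume "f \<in> {f \<in> X. N f = 1}"
  then have f: "f \<in> X" "N f = 1" by auto
  have "average M E f * N (indicator E) = N (\<lambda>x. enn2real (average M E f) * indicator E x)"
    using average_finite[OF E f(1)]
    by (simp add: quasi_norm_scale[OF indicator_basis_in_space[OF E]])
  also have "\<dots> \<le> N (\<lambda>x. enn2real (maximal_function M \<E> f x))"
    by (rule scaled_indicator_le_maximal_function[OF E f(1)])
  also have "\<dots> \<le> operator_norm X N (maximal_function M \<E>)"
    unfolding operator_norm_def using f by (intro SUP_upper) auto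
  finally have "average M E f * N (indicator E) * emeasure M E
      \<le> operator_norm X N (maximal_function M \<E>) * emeasure M E"
    by (intro mult_right_mono) auto
  then show "N (indicator E) * (\<integral>\<^sup>+x. ennreal \<bar>f x * indicator E x\<bar> \<partial>M)
      \<le> operator_norm X N (maximal_function M \<E>) * emeasure M E"
    unfolding integral_eq_average[OF E f(1)] by (simp add: ac_simps)
qed

text \<open>
  Countably many sets of the basis cover the space, so a set of positive measure meets one of
  them in a set of positive measure.
\<close>

lemma saturated_assoc_space: "saturated M (assoc_space M X)"
  unfolding saturated_def
proof (intro ballI impI)
  fix A assume A: "A \<in> sets M" "emeasure M A > 0"
  obtain \<E>' where \<E>': "\<E>' \<subseteq> \<E>" "countable \<E>'" and
    enlarge: "\<forall>\<epsilon>::real. \<epsilon> > 0 \<longrightarrow> (\<forall>E\<in>\<E>. \<exists>E'\<in>\<E>'. E \<subseteq> E' \<and> emeasure M E' \<le> ennreal (1 + \<epsilon>) * emeasure M E)"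
    using basis unfolding basis_of_sets_def by (elim conjE exE) (rule that)
  have cover: "\<exists>E\<in>\<E>'. x \<in> E" if x: "x \<in> space M" for x
  proof -
    have "\<Union>\<E> = space M" using basis by (simp add: basis_of_sets_def)
    then obtain E where "E \<in> \<E>" "x \<in> E" using x by blast
    then show ?thesis using enlarge[rule_format, of 1 E] by auto
  qed
  have "\<exists>E\<in>\<E>'. emeasure M (A \<inter> E) > 0"
  proof (rule ccontr)
    assume "\<not> ?thesis"
    then have "\<forall>E\<in>\<E>'. A \<inter> E \<in> null_sets M"
      using A(1) \<E>'(1) basis_sets(1) by (auto simp: null_sets_def zero_less_iff_neq_zero)
    then have "(\<Union>E\<in>\<E>'. A \<inter> E) \<in> null_sets M"
      using \<E>'(2) by (intro null_sets_UN') auto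
    moreover have "(\<Union>E\<in>\<E>'. A \<inter> E) = A" using cover sets.sets_into_space[OF A(1)] by blast
    ultimately show False using A(2) by auto
  qed
  then obtain E where E: "E \<in> \<E>" "emeasure M (A \<inter> E) > 0" using \<E>'(1) by blast
  have "assoc_norm M X N (indicator (A \<inter> E)) \<le> assoc_norm M X N (indicator E)"
    by (rule assoc_norm_mono) (auto simp: indicator_def)
  then have "(indicator (A \<inter> E) :: 'a \<Rightarrow> real) \<in> assoc_space M X"
    using indicator_basis_in_assoc_space[OF E(1)] A(1) basis_sets(1)[OF E(1)]
    by (auto simp: assoc_space_iff)
  then show "\<exists>F\<in>sets M. F \<subseteq> A \<and> emeasure M F > 0 \<and> (indicator F :: 'a \<Rightarrow> real) \<in> assoc_space M X"
    using E A(1) basis_sets(1)[OF E(1)] by (intro bexI[of _ "A \<inter> E"]) auto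
qed

end

end

theorem lemma2p26:
  fixes M :: "'a measure"
    and \<E> :: "'a set set"
    and X :: "('a \<Rightarrow> real) set"
    and N :: "('a \<Rightarrow> real) \<Rightarrow> ennreal"
  assumes "sigma_finite_measure M"
    and "emeasure M (space M) > 0"
    and "basis_of_sets M \<E>"
    and "quasi_banach_function_space M X N"
    and "bounded_operator_on M X N (maximal_function M \<E>)"
  shows "(\<forall>E\<in>\<E>. indicator E \<in> X \<and> indicator E \<in> assoc_space M X \<and>
            emeasure M E \<le> N (indicator E) * assoc_norm M X N (indicator E) \<and>
            N (indicator E) * assoc_norm M X N (indicator E)
              \<le> operator_norm X N (maximal_function M \<E>) * emeasure M E) \<and>
         saturated M (assoc_space M X) \<and>
         banach_function_space M (assoc_space M X) (assoc_norm M X N)"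
proof -
  note Q = assms(4) and B = assms(3)
  have T: "maps_to_itself M X (maximal_function M \<E>)"
    using assms(5) by (simp add: bounded_operator_on_def)
  note sat = saturated_assoc_space[OF Q B T]
  show ?thesis
    using indicator_basis_in_space[OF Q B T] indicator_basis_in_assoc_space[OF Q B T]
      emeasure_le_norm_mult_assoc_norm[OF Q basis_sets(1)[OF Q B T]]
      norm_mult_assoc_norm_le[OF Q B T] sat banach_function_space_assoc[OF Q sat]
    by blast
qed

end
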